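(* Let $E\subset\mathbb{R}^n$ be an open set (the state manifold) and let $f_0,g$ be smooth vector fields on $E$ and $h:E\to\mathbb{R}$ a smooth function such that the single-input single-output affine control system $\dot x=f_0(x)+g(x)u$, $y=h(x)$, $u\in\mathbb{R}$, has relative degree $r$ with $1\le r<n$ at every point of $E$. Put $f:E\times\mathbb{R}\to TE$, $f(x,u)=f_0(x)+g(x)u\in T_xE$. Let $\Phi:E\to M:=\Phi(E)\subset\mathbb{R}^r$ be the surjective submersion $$\Phi(x)=\bigl[h(x),\,L_{f_0}h(x),\,\dots,\,L_{f_0}^{r-1}h(x)\bigr]^T,$$ let $\Psi:E\times\mathbb{R}\to\mathbb{R}$, $(x,u)\mapsto v=\Psi(x,u)$, be a static feedback transformation, and let $\tilde f:M\times\mathbb{R}\to TM$ be a linear controllable control system on $M$ such that $$T_x\Phi\bigl(f(x,u)\bigr)=\tilde f\bigl(\Phi(x),\Psi(x,u)\bigr)\qquad\text{for all }(x,u)\in E\times\mathbb{R}.$$ Then $E$ can be equipped with a connection $HE$ for $\Phi:E\to M$, i.e. a smooth sub-bundle $HE\subset TE$ with $TE=HE\oplus\ker(T\Phi)$. Moreover, for any such connection, with associated horizontal lift maps $\mathrm{Hor}_x:T_{\Phi(x)}M\to T_xE$, the zero dynamics $$f^Z(x,u):=f(x,u)-\mathrm{Hor}_x\bigl(\tilde f(\Phi(x),\Psi(x,u))\bigr)$$ are vertical, that is, $f^Z(x,u)\in\ker(T_x\Phi)$ for all $(x,u)\in E\times\mathbb{R}$; equivalently, $f^Z(x,u)$ is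 tangent to the fibre $\Phi^{-1}(\Phi(x))$ at $x$.
   Context: $L_Xh$ denotes the Lie derivative of the function $h$ along the vector field $X$, and $L_X^kh$ its $k$-th iterate. The system $\dot x=f_0(x)+g(x)u$, $y=h(x)$ has relative degree $r$ at a point $x^0$ if $L_gL_{f_0}^kh(x)=0$ for all $x$ in a neighbourhood of $x^0$ and all $0\le k<r-1$, and $L_gL_{f_0}^{r-1}h(x^0)\neq 0$. A control system on a manifold $M$ with scalar input is a smooth map $\tilde f:M\times\mathbb{R}\to TM$ with $\tilde f(z,v)\in T_zM$. When $M\subset\mathbb{R}^r$ is open, it is linear and controllable if $\tilde f(z,v)=Az+bv$ for a constant matrix $A\in\mathbb{R}^{r\times r}$ and a constant vector $b\in\mathbb{R}^r$ with $(A,b)$ a controllable pair. For a surjective submersion $\Phi:E\to M$, the vertical bundle is $VE=\ker(T\Phi)\subset TE$. A connection is a smooth sub-bundle $HE\subset TE$ such that $TE=HE\oplus VE$. Given a connection, for $x\in E$ and $Y\in T_{\Phi(x)}M$, the horizontal lift $\mathrm{Hor}_x(Y)$ is the unique vector in $H_xE$ with $T_x\Phi(\mathrm{Hor}_x(Y))=Y$. *)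

theory Defs
  imports "HOL-Analysis.Analysis"
begin

(* Tangent bundles of open subsets of a Euclidean space are trivialised throughout: a tangent
   vector at x is a vector of the ambient space, and the tangent map of F at x is
   frechet_derivative F (at x).  Objects living on an open set E are total functions whose
   values outside E are irrelevant. *)

section \<open>Smooth maps\<close>

(* C^k and C^infinity maps; intended for open S only. *)
primrec Ck_on ::
  "nat \<Rightarrow> 'a::euclidean_space set \<Rightarrow> ('a \<Rightarrow> 'b::euclidean_space) \<Rightarrow> bool" where
  "Ck_on 0 S f \<longleftrightarrow> continuous_on S f"
| "Ck_on (Suc k) S f \<longleftrightarrow>
     (\<forall>x\<in>S. f differentiable (at x)) \<and>
     (\<forall>v. Ck_on k S (\<lambda>x. frechet_derivative f (at x) v))"

definition smooth_on ::
  "'a::euclidean_space set \<Rightarrow> ('a \<Rightarrow> 'b::euclidean_space) \<Rightarrow> bool" where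
  "smooth_on S f \<longleftrightarrow> (\<forall>k. Ck_on k S f)"

definition submersion_on ::
  "'a::euclidean_space set \<Rightarrow> ('a \<Rightarrow> 'b::euclidean_space) \<Rightarrow> bool" where
  "submersion_on E F \<longleftrightarrow> smooth_on E F \<and> (\<forall>x\<in>E. surj (frechet_derivative F (at x)))"

section \<open>Affine control systems and relative degree\<close>

definition lie_derivative ::
  "('a::euclidean_space \<Rightarrow> 'a) \<Rightarrow> ('a \<Rightarrow> real) \<Rightarrow> 'a \<Rightarrow> real" where
  "lie_derivative X h = (\<lambda>x. frechet_derivative h (at x) (X x))"

definition relative_degree_at ::
  "'a::euclidean_space set \<Rightarrow> ('a \<Rightarrow> 'a) \<Rightarrow> ('a \<Rightarrow> 'a) \<Rightarrow> ('a \<Rightarrow> real) \<Rightarrow> nat \<Rightarrow> 'a \<Rightarrow> bool"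
where
  "relative_degree_at E f0 g h r x0 \<longleftrightarrow>
     (\<exists>U. open U \<and> x0 \<in> U \<and> U \<subseteq> E \<and>
        (\<forall>x\<in>U. \<forall>k. k + 1 < r \<longrightarrow> lie_derivative g ((lie_derivative f0 ^^ k) h) x = 0)) \<and>
     lie_derivative g ((lie_derivative f0 ^^ (r - 1)) h) x0 \<noteq> 0"

definition affine_system ::
  "('a::euclidean_space \<Rightarrow> 'a) \<Rightarrow> ('a \<Rightarrow> 'a) \<Rightarrow> 'a \<times> real \<Rightarrow> 'a" where
  "affine_system f0 g = (\<lambda>(x, u). f0 x + u *\<^sub>R g x)"

(* The coordinates of the output space are indexed by a finite type 'r; idx is an enumeration
   of that type by 0, ..., CARD('r) - 1, so that the coordinate numbered k is L_{f0}^k h. *)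
definition output_map ::
  "('r::finite \<Rightarrow> nat) \<Rightarrow> ('a::euclidean_space \<Rightarrow> 'a) \<Rightarrow> ('a \<Rightarrow> real) \<Rightarrow> 'a \<Rightarrow> real ^ 'r" where
  "output_map idx f0 h = (\<lambda>x. \<chi> i. (lie_derivative f0 ^^ idx i) h x)"

(* (x, u) \<mapsto> (x, \<Psi> (x, u)) is a diffeomorphism of E \<times> R onto itself; K is the inverse feedback. *)
definition static_feedback ::
  "'a::euclidean_space set \<Rightarrow> ('a \<times> real \<Rightarrow> real) \<Rightarrow> bool" where
  "static_feedback E \<Psi> \<longleftrightarrow>
     smooth_on (E \<times> UNIV) \<Psi> \<and>
     (\<exists>K. smooth_on (E \<times> UNIV) K \<and>
        (\<forall>x\<in>E. \<forall>u. K (x, \<Psi> (x, u)) = u \<and> \<Psi> (x, K (x, u)) = u))"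

(* Kalman rank condition: the columns b, A b, ..., A^(r-1) b have rank r. *)
definition controllable_pair :: "real ^ 'r ^ 'r \<Rightarrow> real ^ 'r \<Rightarrow> bool" where
  "controllable_pair A b \<longleftrightarrow> dim {(((*v) A) ^^ k) b | k. k < CARD('r)} = CARD('r)"

definition control_system_on ::
  "'a::euclidean_space set \<Rightarrow> ('a \<times> real \<Rightarrow> 'a) \<Rightarrow> bool" where
  "control_system_on M F \<longleftrightarrow> smooth_on (M \<times> UNIV) F"

definition linear_controllable_on ::
  "(real ^ 'r) set \<Rightarrow> ((real ^ 'r) \<times> real \<Rightarrow> real ^ 'r) \<Rightarrow> bool" where
  "linear_controllable_on M F \<longleftrightarrow>
     (\<exists>A b. controllable_pair A b \<and> (\<forall>z\<in>M. \<forall>v. F (z, v) = A *v z + v *\<^sub>R b))"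

section \<open>Vertical bundle, connections and horizontal lifts\<close>

definition vertical_space ::
  "('a::euclidean_space \<Rightarrow> 'b::euclidean_space) \<Rightarrow> 'a \<Rightarrow> 'a set" where
  "vertical_space \<Phi> x = {w. frechet_derivative \<Phi> (at x) w = 0}"

(* A smooth sub-bundle of E \<times> R^n: locally spanned by a smooth frame of k sections. *)
definition smooth_subbundle ::
  "'a::euclidean_space set \<Rightarrow> ('a \<Rightarrow> 'a set) \<Rightarrow> bool" where
  "smooth_subbundle E H \<longleftrightarrow>
     (\<exists>k::nat. \<forall>x\<in>E. \<exists>U X. open U \<and> x \<in> U \<and> U \<subseteq> E \<and>
        (\<forall>i<k. smooth_on U (X i)) \<and>
        (\<forall>y\<in>U. inj_on (\<lambda>i. X i y) {..<k} \<and> independent ((\<lambda>i. X i y) ` {..<k}) \<and>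
               H y = span ((\<lambda>i. X i y) ` {..<k})))"

definition connection ::
  "'a::euclidean_space set \<Rightarrow> ('a \<Rightarrow> 'b::euclidean_space) \<Rightarrow> ('a \<Rightarrow> 'a set) \<Rightarrow> bool" where
  "connection E \<Phi> H \<longleftrightarrow>
     smooth_subbundle E H \<and>
     (\<forall>x\<in>E. H x \<inter> vertical_space \<Phi> x = {0} \<and>
            (\<forall>w. \<exists>a\<in>H x. \<exists>b\<in>vertical_space \<Phi> x. w = a + b))"

definition horizontal_lift ::
  "('a::euclidean_space \<Rightarrow> 'b::euclidean_space) \<Rightarrow> ('a \<Rightarrow> 'a set) \<Rightarrow> 'a \<Rightarrow> 'b \<Rightarrow> 'a" where
  "horizontal_lift \<Phi> H x Y = (THE w. w \<in> H x \<and> frechet_derivative \<Phi> (at x) w = Y)"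

definition zero_dynamics ::
  "('a::euclidean_space \<times> real \<Rightarrow> 'a) \<Rightarrow> ('a \<Rightarrow> 'b::euclidean_space) \<Rightarrow> ('a \<times> real \<Rightarrow> real) \<Rightarrow>
   ('b \<times> real \<Rightarrow> 'b) \<Rightarrow> ('a \<Rightarrow> 'a set) \<Rightarrow> 'a \<times> real \<Rightarrow> 'a" where
  "zero_dynamics f \<Phi> \<Psi> F H =
     (\<lambda>(x, u). f (x, u) - horizontal_lift \<Phi> H x (F (\<Phi> x, \<Psi> (x, u))))"

definition fibre :: "'a set \<Rightarrow> ('a \<Rightarrow> 'b) \<Rightarrow> 'b \<Rightarrow> 'a set" where
  "fibre E \<Phi> z = {y \<in> E. \<Phi> y = z}"

(* w is the velocity at x of a smooth curve contained in S. *)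
definition tangent_to :: "'a::euclidean_space set \<Rightarrow> 'a \<Rightarrow> 'a \<Rightarrow> bool" where
  "tangent_to S x w \<longleftrightarrow>
     (\<exists>\<epsilon>>0. \<exists>c::real \<Rightarrow> 'a. smooth_on {-\<epsilon><..<\<epsilon>} c \<and> c ` {-\<epsilon><..<\<epsilon>} \<subseteq> S \<and>
        c 0 = x \<and> (c has_vector_derivative w) (at 0))"

end

theory Submission
  imports Defs
begin

text \<open>
  Since \<open>T\<^sub>x\<Phi>\<close> maps both \<open>f(x,u)\<close> and the horizontal lift of \<open>ftilde(\<Phi> x, \<Psi>(x,u))\<close> to
  \<open>ftilde(\<Phi> x, \<Psi>(x,u))\<close>, their difference is killed by \<open>T\<^sub>x\<Phi>\<close> (\<open>zero_dynamics_vertical\<close>). The work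
  lies in showing that \<open>\<Phi>\<close> is a submersion, that a connection exists, and that vertical vectors are
  velocities of smooth curves in the fibre.

  \<^item> \<open>\<Phi>\<close> is a submersion because of the relative degree: the pairings of the differentials of
    \<open>h, L\<^sub>f h, \<dots>, L\<^sub>f\<^sup>r\<^sup>-\<^sup>1 h\<close> with the vector fields \<open>g, [f,g], [f,[f,g]], \<dots>\<close> form a triangular matrix
    with nonzero diagonal (\<open>lie_derivative_iterated_bracket\<close>,
    \<open>surj_frechet_derivative_output_map\<close>). This rests on the identity
    \<open>L\<^bsub>[X,Y]\<^esub> = L\<^sub>X L\<^sub>Y - L\<^sub>Y L\<^sub>X\<close>, hence on the symmetry of second derivatives. Submersions being open
    maps, \<open>M\<close> is open.

  \<^item> The orthogonal complement of the vertical bundle is a connection; it has a global smooth frame,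
    the gradients of the coordinates of \<open>\<Phi>\<close> (\<open>connection_range_adjoint\<close>).

  \<^item> Near a point, a submersion is straightened by a diffeomorphism that maps its fibre into a linear
    space; pulling straight lines back gives the curves (\<open>vertical_imp_tangent_to_fibre\<close>). Their
    smoothness comes from a smooth inverse function theorem (\<open>smooth_inverse_function\<close>).
\<close>

section \<open>Calculus of smooth maps\<close>

lemma Ck_on_cong:
  fixes f g :: "'a::euclidean_space \<Rightarrow> 'b::euclidean_space"
  assumes "open S" "\<And>x. x \<in> S \<Longrightarrow> f x = g x" "Ck_on k S f"
  shows "Ck_on k S g"
  using assms(2,3)
proof (induction k arbitrary: f g)
  case 0
  then show ?case by (simp cong: continuous_on_cong)
next
  case (Suc k)
  have der: "(g has_derivative frechet_derivative f (at x)) (at x)" if "x \<in> S" for x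
    using Suc.prems that \<open>open S\<close>
    by (intro has_derivative_transform_within_open[of f _ x UNIV S g])
      (auto simp flip: frechet_derivative_works)
  then have eq: "frechet_derivative f (at x) = frechet_derivative g (at x)" if "x \<in> S" for x
    using frechet_derivative_at that by blast
  show ?case
    unfolding Ck_on.simps
  proof (intro conjI ballI allI)
    show "g differentiable at x" if "x \<in> S" for x
      using der[OF that] by (rule differentiableI)
    show "Ck_on k S (\<lambda>x. frechet_derivative g (at x) v)" for v
      by (rule Suc.IH[where f = "\<lambda>x. frechet_derivative f (at x) v"])
        (use Suc.prems eq in auto)
  qed
qed

text \<open>
  Any family of derivatives may be used in place of the canonical
  \<^const>\<open>frechet_derivative\<close>, so that the usual derivative rules can supply it. Closure of
  the \<open>C\<^sup>k\<close> maps under linear maps, sums, bilinear products, reciprocals and composition follows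
  from this rule by induction on \<open>k\<close>, each derivative formula being built from the maps themselves
  and their derivatives by operations already known to preserve \<open>C\<^sup>k\<close>.
\<close>
lemma Ck_on_SucI:
  fixes f :: "'a::euclidean_space \<Rightarrow> 'b::euclidean_space"
  assumes "open S" "\<And>x. x \<in> S \<Longrightarrow> (f has_derivative f' x) (at x)"
    "\<And>v. Ck_on k S (\<lambda>x. f' x v)"
  shows "Ck_on (Suc k) S f"
  unfolding Ck_on.simps
proof (intro conjI ballI allI)
  show "f differentiable at x" if "x \<in> S" for x
    using assms(2)[OF that] by (rule differentiableI)
  show "Ck_on k S (\<lambda>x. frechet_derivative f (at x) v)" for v
    by (rule Ck_on_cong[OF assms(1) _ assms(3)[of v]]) (use assms(2) frechet_derivative_at in metis)
qed

lemma Ck_on_Suc_has_derivative: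
  "Ck_on (Suc k) S f \<Longrightarrow> x \<in> S \<Longrightarrow> (f has_derivative frechet_derivative f (at x)) (at x)"
  by (simp add: iffD1[OF frechet_derivative_works])

lemma smooth_on_has_derivative:
  "smooth_on S f \<Longrightarrow> x \<in> S \<Longrightarrow> (f has_derivative frechet_derivative f (at x)) (at x)"
  unfolding smooth_on_def using Ck_on_Suc_has_derivative by blast

lemma Ck_on_SucD: "Ck_on (Suc k) S f \<Longrightarrow> Ck_on k S f"
proof (induction k arbitrary: f)
  case 0
  then show ?case
    by (simp add: continuous_at_imp_continuous_on differentiable_imp_continuous_within)
next
  case (Suc k)
  then show ?case by (metis Ck_on.simps(2))
qed

lemma Ck_on_const: "open S \<Longrightarrow> Ck_on k S (\<lambda>x. c)"
  by (induction k arbitrary: c) (auto intro!: Ck_on_SucI derivative_eq_intros simp del: Ck_on.simps(2))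

lemma Ck_on_bounded_linear:
  assumes "open S" "bounded_linear L" "Ck_on k S f"
  shows "Ck_on k S (\<lambda>x. L (f x))"
  using assms(3)
proof (induction k arbitrary: f)
  case 0
  then show ?case using bounded_linear.continuous_on[OF assms(2)] by simp
next
  case (Suc k)
  show ?case
  proof (rule Ck_on_SucI[OF assms(1)])
    show "((\<lambda>x. L (f x)) has_derivative (\<lambda>v. L (frechet_derivative f (at x) v))) (at x)"
      if "x \<in> S" for x
      using bounded_linear.has_derivative[OF assms(2) Ck_on_Suc_has_derivative[OF Suc.prems that]] .
  qed (use Suc in auto)
qed

lemma Ck_on_id: "open S \<Longrightarrow> Ck_on k S (\<lambda>x. x)"
proof (cases k)
  case (Suc m)
  assume "open S"
  then show ?thesis unfolding Suc
    by (rule Ck_on_SucI) (auto intro: has_derivative_ident Ck_on_const[OF \<open>open S\<close>])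
qed simp

lemma Ck_on_add:
  assumes "open S" "Ck_on k S f" "Ck_on k S g"
  shows "Ck_on k S (\<lambda>x. f x + g x)"
  using assms(2,3)
proof (induction k arbitrary: f g)
  case 0
  then show ?case by (simp add: continuous_on_add)
next
  case (Suc k)
  show ?case
    by (rule Ck_on_SucI[OF assms(1) has_derivative_add[OF Ck_on_Suc_has_derivative
            [OF Suc.prems(1)] Ck_on_Suc_has_derivative[OF Suc.prems(2)]]])
      (use Suc in auto)
qed

lemma Ck_on_diff:
  assumes "open S" "Ck_on k S f" "Ck_on k S g"
  shows "Ck_on k S (\<lambda>x. f x - g x)"
  using Ck_on_add[OF assms(1,2) Ck_on_bounded_linear[OF assms(1) bounded_linear_minus
        [OF bounded_linear_ident] assms(3)]] by simp

lemma Ck_on_sum: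
  assumes "open S" "finite I" "\<And>i. i \<in> I \<Longrightarrow> Ck_on k S (f i)"
  shows "Ck_on k S (\<lambda>x. \<Sum>i\<in>I. f i x)"
  using assms(2,3)
  by (induction I rule: finite_induct) (auto intro: Ck_on_add Ck_on_const assms(1))

lemma Ck_on_bilinear:
  fixes f :: "'x::euclidean_space \<Rightarrow> 'a::euclidean_space" and g :: "'x \<Rightarrow> 'b::euclidean_space"
    and B :: "'a \<Rightarrow> 'b \<Rightarrow> 'c::euclidean_space"
  assumes "open S" "bounded_bilinear B" "Ck_on k S f" "Ck_on k S g"
  shows "Ck_on k S (\<lambda>x. B (f x) (g x))"
  using assms(3,4)
proof (induction k arbitrary: f g)
  case 0
  then show ?case using bounded_bilinear.continuous_on[OF assms(2)] by simp
next
  case (Suc k)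
  show ?case
  proof (rule Ck_on_SucI[OF assms(1)])
    show "((\<lambda>x. B (f x) (g x)) has_derivative (\<lambda>v. B (f x) (frechet_derivative g (at x) v)
             + B (frechet_derivative f (at x) v) (g x))) (at x)" if "x \<in> S" for x
      using bounded_bilinear.FDERIV[OF assms(2) Ck_on_Suc_has_derivative[OF Suc.prems(1) that]
          Ck_on_Suc_has_derivative[OF Suc.prems(2) that]] .
    show "Ck_on k S (\<lambda>x. B (f x) (frechet_derivative g (at x) v)
             + B (frechet_derivative f (at x) v) (g x))" for v
      by (intro Ck_on_add assms(1) Suc.IH)
        (use Suc.prems Ck_on_SucD[OF Suc.prems(1)] Ck_on_SucD[OF Suc.prems(2)] in auto)
  qed
qed

lemmas Ck_on_mult = Ck_on_bilinear[OF _ bounded_bilinear_mult]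
lemmas Ck_on_scaleR = Ck_on_bilinear[OF _ bounded_bilinear_scaleR]

lemma Ck_on_prod:
  fixes f :: "'i \<Rightarrow> 'x::euclidean_space \<Rightarrow> real"
  assumes "open S" "finite I" "\<And>i. i \<in> I \<Longrightarrow> Ck_on k S (f i)"
  shows "Ck_on k S (\<lambda>x. \<Prod>i\<in>I. f i x)"
  using assms(2,3)
  by (induction I rule: finite_induct) (auto intro: Ck_on_mult Ck_on_const assms(1))

lemma Ck_on_inverse:
  fixes f :: "'x::euclidean_space \<Rightarrow> real"
  assumes "open S" "\<And>x. x \<in> S \<Longrightarrow> f x \<noteq> 0" "Ck_on k S f"
  shows "Ck_on k S (\<lambda>x. inverse (f x))"
  using assms(3)
proof (induction k)
  case 0
  then show ?case using assms(2) by (auto intro: continuous_on_inverse)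
next
  case (Suc k)
  have IH: "Ck_on k S (\<lambda>x. inverse (f x))"
    using Suc Ck_on_SucD by blast
  show ?case
  proof (rule Ck_on_SucI[OF assms(1)])
    show "((\<lambda>x. inverse (f x)) has_derivative
             (\<lambda>v. - (inverse (f x) * frechet_derivative f (at x) v * inverse (f x)))) (at x)"
      if "x \<in> S" for x
      using Deriv.has_derivative_inverse[OF assms(2)[OF that] Ck_on_Suc_has_derivative[OF Suc.prems that]] .
    show "Ck_on k S (\<lambda>x. - (inverse (f x) * frechet_derivative f (at x) v * inverse (f x)))" for v
      by (rule Ck_on_bounded_linear[OF assms(1) bounded_linear_minus[OF bounded_linear_ident]])
        (use Suc.prems in \<open>auto intro!: Ck_on_mult IH assms(1)\<close>)
  qed
qed

lemma Ck_on_vec_nth: "open S \<Longrightarrow> Ck_on k S f \<Longrightarrow> Ck_on k S (\<lambda>x. f x $ i)"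
  for f :: "'a::euclidean_space \<Rightarrow> real ^ 'm"
  by (rule Ck_on_bounded_linear[OF _ bounded_linear_vec_nth])

lemma Ck_on_vecI:
  fixes f :: "'a::euclidean_space \<Rightarrow> real ^ 'm"
  assumes "open S" "\<And>i. Ck_on k S (\<lambda>x. f x $ i)"
  shows "Ck_on k S f"
proof -
  have "Ck_on k S (\<lambda>x. \<Sum>i\<in>UNIV. f x $ i *\<^sub>R axis i 1)"
    by (intro Ck_on_sum Ck_on_scaleR Ck_on_const assms) auto
  also have "(\<lambda>x. \<Sum>i\<in>UNIV. f x $ i *\<^sub>R axis i 1) = f"
    by (simp add: basis_expansion flip: scalar_mult_eq_scaleR)
  finally show ?thesis .
qed

lemma linear_euclidean_expansion:
  fixes L :: "'a::euclidean_space \<Rightarrow> 'b::real_vector"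
  assumes "linear L"
  shows "L w = (\<Sum>b\<in>Basis. (w \<bullet> b) *\<^sub>R L b)"
proof -
  have "L w = L (\<Sum>b\<in>Basis. (w \<bullet> b) *\<^sub>R b)" by (simp add: euclidean_representation)
  also have "\<dots> = (\<Sum>b\<in>Basis. (w \<bullet> b) *\<^sub>R L b)"
    using assms by (simp add: linear_sum linear_cmul)
  finally show ?thesis .
qed

text \<open>
  Smoothness is defined by fixing the direction of the derivative. Expanding a variable direction in
  an orthonormal basis allows the direction to move with the base point.
\<close>
lemma Ck_on_linear_family_apply:
  assumes "open S" "\<And>x. x \<in> S \<Longrightarrow> linear (L x)" "\<And>v. Ck_on k S (\<lambda>x. L x v)" "Ck_on k S X"
  shows "Ck_on k S (\<lambda>x. L x (X x))"
proof -
  have "Ck_on k S (\<lambda>x. \<Sum>b\<in>Basis. (X x \<bullet> b) *\<^sub>R L x b)"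
    by (intro Ck_on_sum Ck_on_scaleR assms Ck_on_bounded_linear[OF _ bounded_linear_inner_left]) auto
  then show ?thesis
    by (rule Ck_on_cong[OF assms(1), rotated]) (metis assms(2) linear_euclidean_expansion)
qed

text \<open>
  In the induction step the chain rule applies the derivative of the outer map to the moving vector
  \<open>Dp(x) v\<close>; the coefficients \<open>Df(p x) w\<close> are \<open>C\<^sup>k\<close> by the induction hypothesis for the map
  \<open>y \<mapsto> Df(y) w\<close>, which is why the outer map varies in the induction.
\<close>
lemma Ck_on_compose:
  assumes "open S" "open T" "Ck_on k T f" "Ck_on k S p" "p ` S \<subseteq> T"
  shows "Ck_on k S (\<lambda>x. f (p x))"
  using assms(3,4)
proof (induction k arbitrary: f)
  case 0
  then show ?case using assms(5) continuous_on_compose2 by auto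
next
  case (Suc k)
  show ?case
  proof (rule Ck_on_SucI[OF assms(1)])
    show "((\<lambda>x. f (p x)) has_derivative
            (\<lambda>v. frechet_derivative f (at (p x)) (frechet_derivative p (at x) v))) (at x)"
      if "x \<in> S" for x
      by (rule has_derivative_compose[OF Ck_on_Suc_has_derivative[OF Suc.prems(2) that]
             Ck_on_Suc_has_derivative[OF Suc.prems(1)]]) (use assms(5) that in auto)
    show "Ck_on k S (\<lambda>x. frechet_derivative f (at (p x)) (frechet_derivative p (at x) v))" for v
    proof (rule Ck_on_linear_family_apply[OF assms(1),
          where L = "\<lambda>x. frechet_derivative f (at (p x))"])
      show "linear (frechet_derivative f (at (p x)))" if "x \<in> S" for x
        using Suc.prems(1) assms(5) that by (auto intro: linear_frechet_derivative)
      show "Ck_on k S (\<lambda>x. frechet_derivative f (at (p x)) w)" for w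
        by (rule Suc.IH[where f = "\<lambda>y. frechet_derivative f (at y) w"])
          (use Suc.prems(1) Ck_on_SucD[OF Suc.prems(2)] in auto)
    qed (use Suc.prems in auto)
  qed
qed

lemma smooth_on_frechet_derivative:
  "smooth_on S f \<Longrightarrow> smooth_on S (\<lambda>x. frechet_derivative f (at x) v)"
  unfolding smooth_on_def by (metis Ck_on.simps(2))

lemma smooth_on_frechet_derivative_apply:
  assumes "open S" "smooth_on S f" "smooth_on S X"
  shows "smooth_on S (\<lambda>x. frechet_derivative f (at x) (X x))"
  unfolding smooth_on_def
proof
  show "Ck_on k S (\<lambda>x. frechet_derivative f (at x) (X x))" for k
  proof (rule Ck_on_linear_family_apply[OF assms(1),
        where L = "\<lambda>x. frechet_derivative f (at x)"])
    show "linear (frechet_derivative f (at x))" if "x \<in> S" for x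
      using smooth_on_has_derivative[OF assms(2) that] by (rule has_derivative_linear)
  qed (use smooth_on_frechet_derivative[OF assms(2)] assms(3) in \<open>auto simp: smooth_on_def\<close>)
qed

section \<open>Symmetry of second derivatives\<close>

lemma has_real_derivative_along_line:
  fixes F :: "'a::real_normed_vector \<Rightarrow> real"
  assumes "(F has_derivative F') (at (p + t *\<^sub>R v))"
  shows "((\<lambda>t. F (p + t *\<^sub>R v)) has_real_derivative F' v) (at t)"
proof -
  have "((\<lambda>t. F (p + t *\<^sub>R v)) has_derivative (\<lambda>s. F' (s *\<^sub>R v))) (at t)"
    by (rule has_derivative_compose[where f = "\<lambda>t. p + t *\<^sub>R v", OF _ assms])
      (auto intro!: derivative_eq_intros)
  moreover have "F' (s *\<^sub>R v) = s * F' v" for s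
    using has_derivative_linear[OF assms] by (simp add: linear_cmul)
  ultimately show ?thesis
    by (simp add: has_field_derivative_def mult_commute_abs)
qed

text \<open>
  The mean value theorem, applied first in direction \<open>a\<close> to the difference of \<open>\<phi>\<close> over the step
  \<open>s b\<close> and then in direction \<open>b\<close> to \<open>D\<phi> a\<close>, turns the second difference over a small parallelogram
  into a mixed derivative at some point of it. The left side is symmetric in \<open>a\<close> and \<open>b\<close>, whereas
  the order of differentiation on the right is not.
\<close>
lemma second_difference_mean_value:
  fixes \<phi> :: "'a::euclidean_space \<Rightarrow> real"
  assumes \<phi>: "Ck_on (Suc (Suc 0)) S \<phi>" and ball: "ball x d \<subseteq> S"
    and s: "0 < s" "s * (norm a + norm b) < d"
  obtains y where "norm (y - x) \<le> s * (norm a + norm b)"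
    "\<phi> (x + s *\<^sub>R a + s *\<^sub>R b) - \<phi> (x + s *\<^sub>R a) - \<phi> (x + s *\<^sub>R b) + \<phi> x
      = s * s * frechet_derivative (\<lambda>y. frechet_derivative \<phi> (at y) a) (at y) b"
proof -
  let ?D = "\<lambda>y. frechet_derivative \<phi> (at y) a"
  let ?D2 = "\<lambda>y. frechet_derivative ?D (at y) b"
  have norm: "norm (t *\<^sub>R a + u *\<^sub>R b) \<le> s * (norm a + norm b)"
    if "0 \<le> t" "t \<le> s" "0 \<le> u" "u \<le> s" for t u
  proof -
    have "norm (t *\<^sub>R a + u *\<^sub>R b) \<le> t * norm a + u * norm b"
      using that norm_triangle_ineq[of "t *\<^sub>R a" "u *\<^sub>R b"] by simp
    also have "\<dots> \<le> s * norm a + s * norm b"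
      using that by (intro add_mono mult_right_mono) auto
    finally show ?thesis by (simp add: algebra_simps)
  qed
  have mem: "x + t *\<^sub>R a + u *\<^sub>R b \<in> S"
    if "0 \<le> t" "t \<le> s" "0 \<le> u" "u \<le> s" for t u
    using norm[OF that] s ball by (auto simp: dist_norm norm_minus_commute add.assoc subset_iff)
  have mem0: "x + t *\<^sub>R a \<in> S" if "0 \<le> t" "t \<le> s" for t
    using mem[OF that, of 0] s by simp
  define q where "q t = \<phi> ((x + s *\<^sub>R b) + t *\<^sub>R a) - \<phi> (x + t *\<^sub>R a)" for t
  have "(q has_real_derivative ?D ((x + s *\<^sub>R b) + t *\<^sub>R a) - ?D (x + t *\<^sub>R a)) (at t)"
    if "0 \<le> t" "t \<le> s" for t
    unfolding q_def
    by (intro DERIV_diff has_real_derivative_along_line Ck_on_Suc_has_derivative[OF \<phi>])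
      (use mem[of t s] mem0[of t] that s in \<open>auto simp: ac_simps\<close>)
  from MVT2[OF s(1) this] obtain \<theta> where \<theta>: "0 < \<theta>" "\<theta> < s"
    "q s - q 0 = s * (?D ((x + s *\<^sub>R b) + \<theta> *\<^sub>R a) - ?D (x + \<theta> *\<^sub>R a))"
    by auto
  have C1: "Ck_on (Suc 0) S ?D" using \<phi> by (metis Ck_on.simps(2))
  have "((\<lambda>u. ?D ((x + \<theta> *\<^sub>R a) + u *\<^sub>R b)) has_real_derivative
      ?D2 ((x + \<theta> *\<^sub>R a) + u *\<^sub>R b)) (at u)" if "0 \<le> u" "u \<le> s" for u
    by (intro has_real_derivative_along_line Ck_on_Suc_has_derivative[OF C1])
      (use mem[of \<theta> u] \<theta> that in auto)
  from MVT2[OF s(1) this] obtain \<eta> where \<eta>: "0 < \<eta>" "\<eta> < s"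
    "?D ((x + \<theta> *\<^sub>R a) + s *\<^sub>R b) - ?D (x + \<theta> *\<^sub>R a) = s * ?D2 ((x + \<theta> *\<^sub>R a) + \<eta> *\<^sub>R b)"
    by auto
  show thesis
  proof
    show "norm (x + \<theta> *\<^sub>R a + \<eta> *\<^sub>R b - x) \<le> s * (norm a + norm b)"
      using norm[of \<theta> \<eta>] \<theta> \<eta> by (simp add: algebra_simps)
    show "\<phi> (x + s *\<^sub>R a + s *\<^sub>R b) - \<phi> (x + s *\<^sub>R a) - \<phi> (x + s *\<^sub>R b) + \<phi> x
      = s * s * ?D2 (x + \<theta> *\<^sub>R a + \<eta> *\<^sub>R b)"
      using \<theta>(3) \<eta>(3) by (simp add: q_def algebra_simps)
  qed
qed

text \<open>
  Schwarz's theorem: both orders of differentiation give the same second difference divided by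
  \<open>s\<^sup>2\<close>, at points arbitrarily close to \<open>x\<close>, so by continuity they agree at \<open>x\<close>.
\<close>
lemma second_derivative_symmetric:
  fixes \<phi> :: "'a::euclidean_space \<Rightarrow> real"
  assumes "open S" and \<phi>: "Ck_on (Suc (Suc 0)) S \<phi>" and "x \<in> S"
  shows "frechet_derivative (\<lambda>y. frechet_derivative \<phi> (at y) a) (at x) b
       = frechet_derivative (\<lambda>y. frechet_derivative \<phi> (at y) b) (at x) a"
    (is "?F x = ?G x")
proof (rule ccontr)
  assume ne: "?F x \<noteq> ?G x"
  define e where "e = \<bar>?F x - ?G x\<bar> / 2"
  have "e > 0" using ne by (simp add: e_def)
  have "continuous_on S ?F" "continuous_on S ?G" using \<phi> by auto
  then have "isCont ?F x" "isCont ?G x"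
    using assms by (auto simp: continuous_on_eq_continuous_at)
  then obtain d1 d2 where d12: "d1 > 0" "d2 > 0"
    "\<And>y. norm (y - x) < d1 \<Longrightarrow> \<bar>?F y - ?F x\<bar> < e"
    "\<And>y. norm (y - x) < d2 \<Longrightarrow> \<bar>?G y - ?G x\<bar> < e"
    using \<open>e > 0\<close> unfolding continuous_at_eps_delta dist_norm real_norm_def by metis
  obtain d3 where d3: "d3 > 0" "ball x d3 \<subseteq> S"
    using assms openE by blast
  define d where "d = min d3 (min d1 d2)"
  have "d > 0" using d12 d3 by (simp add: d_def)
  \<comment> \<open>the extra 1 keeps the step positive and admissible when both directions vanish\<close>
  define s where "s = d / (norm a + norm b + 1)"
  have pos: "norm a + norm b + 1 > 0" by (smt (verit) norm_ge_zero)
  have "s > 0" using \<open>d > 0\<close> pos by (simp add: s_def)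
  moreover have "s * (norm a + norm b) < d"
    using pos \<open>d > 0\<close> by (simp add: s_def field_simps)
  ultimately have s: "s > 0" "s * (norm a + norm b) < d" "s * (norm b + norm a) < d"
    by (auto simp: add.commute)
  have ball: "ball x d \<subseteq> S" using d3 by (auto simp: d_def)
  obtain y where y: "norm (y - x) < d"
    "\<phi> (x + s *\<^sub>R a + s *\<^sub>R b) - \<phi> (x + s *\<^sub>R a) - \<phi> (x + s *\<^sub>R b) + \<phi> x = s * s * ?F y"
    using second_difference_mean_value[OF \<phi> ball s(1,2)] s by (smt (verit))
  obtain z where z: "norm (z - x) < d"
    "\<phi> (x + s *\<^sub>R b + s *\<^sub>R a) - \<phi> (x + s *\<^sub>R b) - \<phi> (x + s *\<^sub>R a) + \<phi> x = s * s * ?G z"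
    using second_difference_mean_value[OF \<phi> ball s(1,3)] s by (smt (verit))
  have "s * s * ?F y = s * s * ?G z"
    using y(2) z(2) by (simp add: algebra_simps)
  then have "?F y = ?G z" using s by simp
  moreover have "\<bar>?F y - ?F x\<bar> < e" "\<bar>?G z - ?G x\<bar> < e"
    using d12 y z by (auto simp: d_def)
  ultimately have "\<bar>?F x - ?G x\<bar> < e + e" by (smt (verit))
  then show False by (simp add: e_def)
qed

section \<open>Lie brackets and Lie derivatives\<close>

definition lie_bracket ::
  "('a::euclidean_space \<Rightarrow> 'a) \<Rightarrow> ('a \<Rightarrow> 'a) \<Rightarrow> 'a \<Rightarrow> 'a" where
  "lie_bracket X Y =
     (\<lambda>x. frechet_derivative Y (at x) (X x) - frechet_derivative X (at x) (Y x))"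

lemma smooth_on_lie_derivative:
  "open S \<Longrightarrow> smooth_on S X \<Longrightarrow> smooth_on S \<phi> \<Longrightarrow> smooth_on S (lie_derivative X \<phi>)"
  unfolding lie_derivative_def by (rule smooth_on_frechet_derivative_apply)

lemma smooth_on_lie_derivative_funpow:
  "open S \<Longrightarrow> smooth_on S X \<Longrightarrow> smooth_on S \<phi> \<Longrightarrow> smooth_on S ((lie_derivative X ^^ k) \<phi>)"
  by (induction k) (auto intro: smooth_on_lie_derivative)

lemma smooth_on_lie_bracket:
  assumes "open S" "smooth_on S X" "smooth_on S Y"
  shows "smooth_on S (lie_bracket X Y)"
  using smooth_on_frechet_derivative_apply[OF assms]
    smooth_on_frechet_derivative_apply[OF assms(1,3,2)]
  by (auto simp: lie_bracket_def smooth_on_def intro: Ck_on_diff assms(1))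

lemma smooth_on_lie_bracket_funpow:
  "open S \<Longrightarrow> smooth_on S X \<Longrightarrow> smooth_on S Y \<Longrightarrow> smooth_on S ((lie_bracket X ^^ k) Y)"
  by (induction k) (auto intro: smooth_on_lie_bracket)

text \<open>
  The product rule for \<open>y \<mapsto> D\<phi>(y) (X y)\<close>, with the second derivative written so that the
  direction of the outer derivative \<open>v\<close> is held fixed; this uses its symmetry and is the form in
  which the second-order terms of a commutator visibly cancel.
\<close>
lemma frechet_derivative_lie_derivative:
  assumes "open S" "smooth_on S X" "smooth_on S \<phi>" "x \<in> S"
  shows "frechet_derivative (lie_derivative X \<phi>) (at x) v =
     frechet_derivative (\<lambda>y. frechet_derivative \<phi> (at y) v) (at x) (X x) +
     frechet_derivative \<phi> (at x) (frechet_derivative X (at x) v)"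
proof -
  let ?D = "\<lambda>b y. frechet_derivative \<phi> (at y) b"
  have C2: "Ck_on (Suc (Suc 0)) S \<phi>" using assms(3) unfolding smooth_on_def by blast
  have lin: "linear (frechet_derivative F (at y))" if "smooth_on S F" "y \<in> S"
    for F :: "'a \<Rightarrow> 'c::euclidean_space" and y
    using smooth_on_has_derivative[OF that] by (rule has_derivative_linear)
  have "((\<lambda>y. \<Sum>b\<in>Basis. (X y \<bullet> b) * ?D b y) has_derivative
      (\<lambda>v. \<Sum>b\<in>Basis. (X x \<bullet> b) * frechet_derivative (?D b) (at x) v +
                        (frechet_derivative X (at x) v \<bullet> b) * ?D b x)) (at x)"
    by (intro has_derivative_sum has_derivative_mult has_derivative_inner_left
        smooth_on_has_derivative[OF assms(2,4)]
        smooth_on_has_derivative[OF smooth_on_frechet_derivative[OF assms(3)] assms(4)])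
  then have "(lie_derivative X \<phi> has_derivative
      (\<lambda>v. \<Sum>b\<in>Basis. (X x \<bullet> b) * frechet_derivative (?D b) (at x) v +
                        (frechet_derivative X (at x) v \<bullet> b) * ?D b x)) (at x)"
    by (rule has_derivative_transform_within_open[OF _ assms(1,4)])
      (simp add: lie_derivative_def linear_euclidean_expansion[OF lin[OF assms(3)], of _ "X _"])
  then have "frechet_derivative (lie_derivative X \<phi>) (at x) v =
      (\<Sum>b\<in>Basis. (X x \<bullet> b) * frechet_derivative (?D b) (at x) v) +
      (\<Sum>b\<in>Basis. (frechet_derivative X (at x) v \<bullet> b) * ?D b x)"
    by (simp add: frechet_derivative_at[symmetric] sum.distrib)
  also have "(\<Sum>b\<in>Basis. (X x \<bullet> b) * frechet_derivative (?D b) (at x) v)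
      = (\<Sum>b\<in>Basis. (X x \<bullet> b) * frechet_derivative (?D v) (at x) b)"
    by (intro sum.cong refl arg_cong2[where f = "(*)"]
        second_derivative_symmetric[OF assms(1) C2 assms(4)])
  also have "\<dots> = frechet_derivative (?D v) (at x) (X x)"
    using linear_euclidean_expansion[OF lin[OF smooth_on_frechet_derivative[OF assms(3)] assms(4)],
        of v "X x"] by simp
  also have "(\<Sum>b\<in>Basis. (frechet_derivative X (at x) v \<bullet> b) * ?D b x)
      = frechet_derivative \<phi> (at x) (frechet_derivative X (at x) v)"
    using linear_euclidean_expansion[OF lin[OF assms(3,4)], of "frechet_derivative X (at x) v"]
    by simp
  finally show ?thesis .
qed

lemma lie_derivative_lie_bracket:
  assumes "open S" "smooth_on S X" "smooth_on S Y" "smooth_on S \<phi>" "x \<in> S"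
  shows "lie_derivative (lie_bracket X Y) \<phi> x =
     lie_derivative X (lie_derivative Y \<phi>) x - lie_derivative Y (lie_derivative X \<phi>) x"
proof -
  have "Ck_on (Suc (Suc 0)) S \<phi>" using assms(4) unfolding smooth_on_def by blast
  note sym = second_derivative_symmetric[OF assms(1) this assms(5)]
  have "linear (frechet_derivative \<phi> (at x))"
    using smooth_on_has_derivative[OF assms(4,5)] by (rule has_derivative_linear)
  then have "lie_derivative (lie_bracket X Y) \<phi> x =
      frechet_derivative \<phi> (at x) (frechet_derivative Y (at x) (X x)) -
      frechet_derivative \<phi> (at x) (frechet_derivative X (at x) (Y x))"
    by (simp add: lie_derivative_def lie_bracket_def linear_diff)
  then show ?thesis
    unfolding lie_derivative_def[of X "lie_derivative Y \<phi>"] lie_derivative_def[of Y "lie_derivative X \<phi>"]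
      frechet_derivative_lie_derivative[OF assms(1,3,4,5)]
      frechet_derivative_lie_derivative[OF assms(1,2,4,5)]
    using sym[of "X x" "Y x"] by simp
qed

lemma lie_derivative_zero:
  assumes "open S" "x \<in> S" "\<And>y. y \<in> S \<Longrightarrow> \<phi> y = 0"
  shows "lie_derivative X \<phi> x = 0"
proof -
  have "(\<phi> has_derivative (\<lambda>v. 0)) (at x)"
    by (rule has_derivative_transform_within_open[OF has_derivative_const[of 0] assms(1,2)])
      (use assms(3) in simp)
  then show ?thesis
    by (simp add: lie_derivative_def frechet_derivative_at[symmetric])
qed

text \<open>
  Writing the bracket as a commutator of Lie derivatives trades one bracket for one more derivative
  along \<open>f\<close> of the output, up to sign: the other term of the commutator is the derivative of a
  function that vanishes identically on \<open>E\<close>. By induction only the total number of brackets and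
  derivatives matters, and everything reduces to the defining conditions of the relative degree.
  This is where their validity on an open set, rather than at a single point, enters.
\<close>
lemma lie_derivative_iterated_bracket:
  assumes "open E" "smooth_on E f" "smooth_on E g" "smooth_on E h"
    and deg: "\<forall>x\<in>E. \<forall>k. k + 1 < r \<longrightarrow> lie_derivative g ((lie_derivative f ^^ k) h) x = 0"
    and "x \<in> E"
  shows "i + j + 1 < r \<Longrightarrow>
           lie_derivative ((lie_bracket f ^^ i) g) ((lie_derivative f ^^ j) h) x = 0"
    and "i + j + 1 = r \<Longrightarrow>
           lie_derivative ((lie_bracket f ^^ i) g) ((lie_derivative f ^^ j) h) x =
           (-1) ^ i * lie_derivative g ((lie_derivative f ^^ (r - 1)) h) x"
proof -
  let ?X = "\<lambda>i. (lie_bracket f ^^ i) g" and ?\<phi> = "\<lambda>j. (lie_derivative f ^^ j) h"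
  have "(i + j + 1 < r \<longrightarrow> lie_derivative (?X i) (?\<phi> j) x = 0) \<and>
        (i + j + 1 = r \<longrightarrow>
           lie_derivative (?X i) (?\<phi> j) x = (-1) ^ i * lie_derivative g (?\<phi> (r - 1)) x)"
    using \<open>x \<in> E\<close>
  proof (induction i arbitrary: j x)
    case 0
    then show ?case using deg by auto
  next
    case (Suc i)
    have "lie_derivative (?X (Suc i)) (?\<phi> j) x =
        lie_derivative f (lie_derivative (?X i) (?\<phi> j)) x -
        lie_derivative (?X i) (?\<phi> (Suc j)) x"
      using lie_derivative_lie_bracket[OF assms(1,2)
          smooth_on_lie_bracket_funpow[OF assms(1-3)]
          smooth_on_lie_derivative_funpow[OF assms(1,2,4)] Suc.prems] by simp
    moreover have "lie_derivative f (lie_derivative (?X i) (?\<phi> j)) x = 0" if "Suc i + j + 1 \<le> r"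
      by (rule lie_derivative_zero[OF assms(1) Suc.prems]) (use Suc.IH[of _ j] that in auto)
    ultimately show ?case
      using Suc.IH[OF Suc.prems, of "Suc j"] by auto
  qed
  then show "i + j + 1 < r \<Longrightarrow> lie_derivative (?X i) (?\<phi> j) x = 0"
    and "i + j + 1 = r \<Longrightarrow>
      lie_derivative (?X i) (?\<phi> j) x = (-1) ^ i * lie_derivative g (?\<phi> (r - 1)) x"
    by auto
qed

section \<open>The output map is a submersion\<close>

lemma smooth_on_output_map:
  assumes "open E" "smooth_on E f" "smooth_on E h"
  shows "smooth_on E (output_map idx f h)"
  using smooth_on_lie_derivative_funpow[OF assms]
  unfolding smooth_on_def output_map_def by (auto intro!: Ck_on_vecI assms(1))

lemma frechet_derivative_vec_nth:
  fixes F :: "'a::euclidean_space \<Rightarrow> real ^ 'm"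
  assumes "(F has_derivative F') (at x)"
  shows "frechet_derivative (\<lambda>y. F y $ i) (at x) w = F' w $ i"
  using frechet_derivative_at[OF bounded_linear.has_derivative[OF bounded_linear_vec_nth assms]]
  by metis

lemma frechet_derivative_output_map_nth:
  assumes "open E" "smooth_on E f" "smooth_on E h" "x \<in> E"
  shows "frechet_derivative (output_map idx f h) (at x) w $ i =
         frechet_derivative ((lie_derivative f ^^ idx i) h) (at x) w"
  using frechet_derivative_vec_nth[OF smooth_on_has_derivative
      [OF smooth_on_output_map[OF assms(1-3)] assms(4)], of idx i w]
  by (simp add: output_map_def)

text \<open>
  Apply the differentials of the coordinates to the iterated brackets \<open>ad\<^sub>f\<^sup>m g\<close>: up to the order of
  the rows this is a triangular matrix whose diagonal entries are \<open>\<plusminus> L\<^sub>g L\<^sub>f\<^sup>r\<^sup>-\<^sup>1 h \<noteq> 0\<close>. A vector \<open>c\<close>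
  orthogonal to the range of the differential is annihilated by this matrix, so its entries vanish one
  after another, starting from the coordinate with the most derivatives.
\<close>
lemma surj_frechet_derivative_output_map:
  fixes idx :: "'r::finite \<Rightarrow> nat"
  assumes "open E" "smooth_on E f" "smooth_on E g" "smooth_on E h"
    and idx: "bij_betw idx UNIV {..<r}"
    and deg: "\<And>x. x \<in> E \<Longrightarrow> relative_degree_at E f g h r x"
    and "x \<in> E"
  shows "surj (frechet_derivative (output_map idx f h) (at x))"
proof (rule ccontr)
  let ?D = "frechet_derivative (output_map idx f h) (at x)"
  let ?L = "\<lambda>i j. lie_derivative ((lie_bracket f ^^ i) g) ((lie_derivative f ^^ j) h) x"
  let ?\<beta> = "lie_derivative g ((lie_derivative f ^^ (r - 1)) h) x"
  assume "\<not> surj ?D"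
  have lin: "linear ?D"
    using smooth_on_has_derivative[OF smooth_on_output_map[OF assms(1,2,4)] assms(7)]
    by (rule has_derivative_linear)
  then have sub: "subspace (range ?D)"
    using linear_subspace_image subspace_UNIV by blast
  have "dim (range ?D) \<noteq> DIM(real ^ 'r)"
    using \<open>\<not> surj ?D\<close> sub by (metis dim_eq_full span_eq_iff)
  then have "dim (range ?D) < DIM(real ^ 'r)"
    using dim_subset_UNIV[of "range ?D"] by linarith
  then obtain c where c: "c \<noteq> 0" "\<And>w. orthogonal c (?D w)"
    using orthogonal_to_subspace_exists by (metis rangeI span_base)
  have ann: "(\<Sum>i\<in>UNIV. c $ i * ?L m (idx i)) = 0" for m
    using c(2)[of "(lie_bracket f ^^ m) g x"]
    by (simp add: orthogonal_def inner_vec_def lie_derivative_def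
        frechet_derivative_output_map_nth[OF assms(1,2,4,7)])
  have zero: "\<forall>x\<in>E. \<forall>k. k + 1 < r \<longrightarrow> lie_derivative g ((lie_derivative f ^^ k) h) x = 0"
    and \<beta>: "?\<beta> \<noteq> 0"
    using deg \<open>x \<in> E\<close> unfolding relative_degree_at_def by blast+
  note L = lie_derivative_iterated_bracket[OF assms(1-4) zero \<open>x \<in> E\<close>]
  have "c $ i = 0" if "idx i + m + 1 = r" for m i
    using that
  proof (induction m arbitrary: i rule: less_induct)
    case (less m)
    \<comment> \<open>the entry vanishes for fewer than \<open>r - 1 - m\<close> derivatives, and the coefficient does for more\<close>
    have "c $ k * ?L m (idx k) = (if k = i then c $ i * ((-1) ^ m * ?\<beta>) else 0)" for k
    proof (cases "idx k" "idx i" rule: linorder_cases)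
      case less
      then show ?thesis using L(1)[of m "idx k"] \<open>idx i + m + 1 = r\<close> by auto
    next
      case equal
      then have "k = i" using idx by (auto simp: bij_betw_def inj_on_def)
      then show ?thesis using L(2)[of m "idx i"] \<open>idx i + m + 1 = r\<close> by (auto simp: ac_simps)
    next
      case greater
      have "idx k < r" using idx by (auto simp: bij_betw_def)
      then have "c $ k = 0"
        using less.IH[of "r - idx k - 1" k] greater \<open>idx i + m + 1 = r\<close> by auto
      then show ?thesis using greater by auto
    qed
    then have "c $ i * ((-1) ^ m * ?\<beta>) = 0"
      using ann[of m] by simp
    then show ?case using \<beta> by simp
  qed
  moreover have "idx i < r" for i using idx by (auto simp: bij_betw_def)
  ultimately have "c $ i = 0" for i
    by (metis Suc_eq_plus1 add_Suc_right less_imp_Suc_add)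
  then show False using c(1) by (simp add: vec_eq_iff)
qed

section \<open>The smooth inverse function theorem\<close>

lemma Ck_on_det:
  fixes A :: "'a::euclidean_space \<Rightarrow> real ^ 'n ^ 'n"
  assumes "open S" "\<And>i j. Ck_on k S (\<lambda>x. A x $ i $ j)"
  shows "Ck_on k S (\<lambda>x. det (A x))"
  unfolding det_def
  by (intro Ck_on_sum Ck_on_mult Ck_on_prod Ck_on_const assms) (auto simp: finite_permutations)

text \<open>
  Cramer's rule presents the inverse matrix as a rational function of the entries.
\<close>
lemma Ck_on_inv_apply:
  fixes L :: "'a::euclidean_space \<Rightarrow> real ^ 'n \<Rightarrow> real ^ 'n"
  assumes "open S" and L: "\<And>x. x \<in> S \<Longrightarrow> linear (L x)" "\<And>x. x \<in> S \<Longrightarrow> bij (L x)"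
    and Ck: "\<And>v. Ck_on k S (\<lambda>x. L x v)"
  shows "Ck_on k S (\<lambda>x. inv (L x) v)"
proof (rule Ck_on_vecI[OF assms(1)])
  fix m
  let ?N = "\<lambda>x. \<chi> i j. if j = m then v $ i else matrix (L x) $ i $ j"
  have entries: "Ck_on k S (\<lambda>x. matrix (L x) $ i $ j)" for i j
    using Ck_on_vec_nth[OF assms(1) Ck] by (simp add: matrix_def)
  have nz: "det (matrix (L x)) \<noteq> 0" if "x \<in> S" for x
    using L[OF that] by (simp add: det_nz_iff_inj bij_is_inj)
  have "det (?N x) * inverse (det (matrix (L x))) = inv (L x) v $ m" if "x \<in> S" for x
  proof -
    have "matrix (L x) *v inv (L x) v = v"
      using L[OF that] by (simp add: matrix_works bij_is_surj surj_f_inv_f)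
    then show ?thesis
      using cramer[OF nz[OF that], of "inv (L x) v" v] by (simp add: divide_inverse)
  qed
  moreover have "Ck_on k S (\<lambda>x. ?N x $ i $ j)" for i j
    using entries[of i j] Ck_on_const[OF assms(1)] by (cases "j = m") auto
  then have "Ck_on k S (\<lambda>x. det (?N x) * inverse (det (matrix (L x))))"
    by (intro Ck_on_mult Ck_on_inverse Ck_on_det assms(1) nz entries) auto
  ultimately show "Ck_on k S (\<lambda>x. inv (L x) v $ m)"
    by (rule Ck_on_cong[OF assms(1)])
qed

text \<open>
  The \<open>C\<^sup>1\<close> inverse function theorem gives a local inverse \<open>G\<close> with derivative \<open>DF(G y)\<^sup>-\<^sup>1\<close>. This
  formula bootstraps: if \<open>G\<close> is \<open>C\<^sup>k\<close>, then so is its derivative, hence \<open>G\<close> is \<open>C\<^sup>k\<^sup>+\<^sup>1\<close>.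
\<close>
lemma smooth_inverse_function:
  fixes F :: "real ^ 'n \<Rightarrow> real ^ 'n"
  assumes "open S" and F: "smooth_on S F" and "x0 \<in> S"
    and bij: "bij (frechet_derivative F (at x0))"
  obtains U V G where "open U" "x0 \<in> U" "U \<subseteq> S" "open V" "F x0 \<in> V"
    "homeomorphism U V F G" "smooth_on V G"
proof -
  let ?D = "\<lambda>x. frechet_derivative F (at x)"
  note der = smooth_on_has_derivative[OF F]
  \<comment> \<open>outside \<open>S\<close> the derivative need not be linear, so \<open>Blinfun\<close> is meaningful only on \<open>S\<close>\<close>
  have apply_D: "blinfun_apply (Blinfun (?D x)) = ?D x" if "x \<in> S" for x
    using has_derivative_bounded_linear[OF der[OF that]] by (rule bounded_linear_Blinfun_apply)
  have cont: "continuous_on S (\<lambda>x. ?D x v)" for v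
    using smooth_on_frechet_derivative[OF F, of v] unfolding smooth_on_def by (metis Ck_on.simps(1))
  have contD: "continuous_on S (\<lambda>x. Blinfun (?D x))"
    using cont apply_D
    by (intro continuous_on_blinfun_componentwise) (simp cong: continuous_on_cong)
  have "linear (inv (?D x0))"
    using inj_linear_imp_inv_linear[OF has_derivative_linear[OF der[OF \<open>x0 \<in> S\<close>]]] bij
    by (simp add: bij_is_inj)
  then have apply_inv: "blinfun_apply (Blinfun (inv (?D x0))) = inv (?D x0)"
    by (simp add: bounded_linear_Blinfun_apply linear_conv_bounded_linear)
  have inv: "Blinfun (inv (?D x0)) o\<^sub>L Blinfun (?D x0) = id_blinfun"
    by (rule blinfun_eqI) (simp add: apply_inv apply_D[OF \<open>x0 \<in> S\<close>] bij bij_is_inj)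
  have derF: "(F has_derivative blinfun_apply (Blinfun (?D x))) (at x)" if "x \<in> S" for x
    using der[OF that] by (simp add: apply_D[OF that])
  obtain U V G G' where UV: "open U" "U \<subseteq> S" "x0 \<in> U" "open V" "F x0 \<in> V" "homeomorphism U V F G"
    and G': "\<And>y. y \<in> V \<Longrightarrow> (G has_derivative G' y) (at y)"
      "\<And>y. y \<in> V \<Longrightarrow> G' y = inv (blinfun_apply (Blinfun (?D (G y))))"
      "\<And>y. y \<in> V \<Longrightarrow> bij (blinfun_apply (Blinfun (?D (G y))))"
    by (rule inverse_function_theorem[OF \<open>open S\<close> derF contD \<open>x0 \<in> S\<close> inv]) blast+
  have GS: "G y \<in> S" if "y \<in> V" for y
    using UV(2,6) that by (auto simp: homeomorphism_def)
  have "Ck_on k V G" for k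
  proof (induction k)
    case 0
    then show ?case using UV(6) by (simp add: homeomorphism_def)
  next
    case (Suc k)
    show ?case
    proof (rule Ck_on_SucI[OF UV(4)])
      show "(G has_derivative inv (?D (G y))) (at y)" if "y \<in> V" for y
        using G'(1,2)[OF that] apply_D[OF GS[OF that]] by simp
      show "Ck_on k V (\<lambda>y. inv (?D (G y)) v)" for v
      proof (rule Ck_on_inv_apply[OF UV(4), where L = "\<lambda>y. ?D (G y)"])
        show "linear (?D (G y))" if "y \<in> V" for y
          using der[OF GS[OF that]] by (rule has_derivative_linear)
        show "bij (?D (G y))" if "y \<in> V" for y
          using G'(3)[OF that] apply_D[OF GS[OF that]] by simp
        show "Ck_on k V (\<lambda>y. ?D (G y) w)" for w
          using smooth_on_frechet_derivative[OF F, of w] GS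
          by (intro Ck_on_compose[OF UV(4) assms(1) _ Suc.IH, where f = "\<lambda>x. ?D x w"])
            (auto simp: smooth_on_def)
      qed
    qed
  qed
  then have "smooth_on V G" by (simp add: smooth_on_def)
  with that UV show thesis by blast
qed

section \<open>Fibres, images and connections of a submersion\<close>

text \<open>
  A submersion is straightened by a single chart of the total space. With a linear right inverse \<open>R\<close> of
  \<open>D = D\<Phi>(x)\<close>, the map \<open>F y = R (\<Phi> y - \<Phi> x) + (y - x) - R (D (y - x))\<close> has derivative the identity
  at \<open>x\<close>, and \<open>D (F y) = \<Phi> y - \<Phi> x\<close> for every \<open>y\<close>. Thus \<open>F\<close> carries the fibre through \<open>x\<close> into the
  linear space \<open>ker D\<close>, and near \<open>x\<close> the preimage of the line spanned by a vertical vector \<open>w\<close>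
  is a smooth curve in that fibre with velocity \<open>w\<close>.
\<close>
lemma vertical_imp_tangent_to_fibre:
  fixes \<Phi> :: "real ^ 'n \<Rightarrow> 'b::euclidean_space"
  assumes "open E" and "submersion_on E \<Phi>" and "x \<in> E" and w: "w \<in> vertical_space \<Phi> x"
  shows "tangent_to (fibre E \<Phi> (\<Phi> x)) x w"
proof -
  let ?D = "frechet_derivative \<Phi> (at x)"
  have \<Phi>: "smooth_on E \<Phi>" and surj: "surj ?D"
    using assms(2,3) by (auto simp: submersion_on_def)
  note der = smooth_on_has_derivative[OF \<Phi> \<open>x \<in> E\<close>]
  have lin: "linear ?D" using der by (rule has_derivative_linear)
  obtain R where R: "linear R" "\<And>z. ?D (R z) = z"
    using linear_surjective_right_inverse[OF lin surj] by (auto simp: fun_eq_iff)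
  have bl: "bounded_linear R" "bounded_linear ?D"
    using R(1) lin by (simp_all add: linear_conv_bounded_linear)
  define F where "F y = R (\<Phi> y - \<Phi> x) + (y - x) - R (?D (y - x))" for y
  have DF: "?D (F y) = \<Phi> y - \<Phi> x" for y
    unfolding F_def using R(2) by (simp add: linear_add[OF lin] linear_diff[OF lin])
  have Fx: "F x = 0" by (simp add: F_def linear_0[OF R(1)] linear_0[OF lin])
  have smooth: "smooth_on E F"
    unfolding smooth_on_def F_def
    using \<Phi> by (auto simp: smooth_on_def intro!: Ck_on_add Ck_on_diff Ck_on_const Ck_on_id
        Ck_on_bounded_linear[OF _ bl(1)] Ck_on_bounded_linear[OF _ bl(2)] \<open>open E\<close>)
  have derF: "(F has_derivative (\<lambda>v. v)) (at x)"
  proof -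
    have "(F has_derivative (\<lambda>v. R (?D v - 0) + (v - 0) - R (?D (v - 0)))) (at x)"
      unfolding F_def
      by (intro has_derivative_add has_derivative_diff bounded_linear.has_derivative[OF bl(1)]
          bounded_linear.has_derivative[OF bl(2)] der has_derivative_const has_derivative_ident)
    then show ?thesis by simp
  qed
  then have "frechet_derivative F (at x) = (\<lambda>v. v)"
    using frechet_derivative_at by metis
  then have "bij (frechet_derivative F (at x))"
    by (simp add: bij_def inj_on_def surj_def)
  from smooth_inverse_function[OF \<open>open E\<close> smooth \<open>x \<in> E\<close> this]
  obtain U V G where UV: "open U" "x \<in> U" "U \<subseteq> E" "open V" "F x \<in> V"
    "homeomorphism U V F G" "smooth_on V G" .
  have GU: "G z \<in> U" "F (G z) = z" if "z \<in> V" for z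
    using UV(6) that by (auto simp: homeomorphism_def)
  have GF: "G (F y) = y" if "y \<in> U" for y
    using UV(6) that by (auto simp: homeomorphism_def)
  have G0: "G 0 = x" using GF[OF UV(2)] Fx by simp
  have derG: "(G has_derivative (\<lambda>v. v)) (at 0)"
  proof -
    have "0 \<in> V" using UV(5) Fx by simp
    note G = smooth_on_has_derivative[OF UV(7) this]
    have "((\<lambda>y. G (F y)) has_derivative (\<lambda>v. frechet_derivative G (at 0) v)) (at x)"
      by (rule has_derivative_compose[OF derF]) (use G Fx in simp)
    moreover have "((\<lambda>y. G (F y)) has_derivative (\<lambda>v. v)) (at x)"
      by (rule has_derivative_transform_within_open[OF has_derivative_ident UV(1,2)])
        (simp add: GF)
    ultimately have "frechet_derivative G (at 0) = (\<lambda>v. v)"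
      using has_derivative_unique by blast
    then show ?thesis using G by simp
  qed
  have "open ((\<lambda>t::real. t *\<^sub>R w) -` V)"
    by (intro open_vimage UV(4) continuous_intros)
  moreover have "0 \<in> (\<lambda>t::real. t *\<^sub>R w) -` V" using UV(5) Fx by simp
  ultimately obtain \<epsilon> where \<epsilon>: "\<epsilon> > 0" "ball 0 \<epsilon> \<subseteq> (\<lambda>t::real. t *\<^sub>R w) -` V"
    by (rule openE)
  then have V: "t *\<^sub>R w \<in> V" if "t \<in> {-\<epsilon><..<\<epsilon>}" for t
    using that by (auto simp: subset_iff dist_norm abs_less_iff)
  define c where "c t = G (t *\<^sub>R w)" for t :: real
  show ?thesis
    unfolding tangent_to_def
  proof (intro exI[of _ \<epsilon>] exI[of _ c] conjI \<epsilon>(1))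
    show "smooth_on {-\<epsilon><..<\<epsilon>} c"
      unfolding smooth_on_def c_def
    proof
      show "Ck_on k {-\<epsilon><..<\<epsilon>} (\<lambda>t. G (t *\<^sub>R w))" for k
      proof (rule Ck_on_compose[OF _ UV(4), where f = G and p = "\<lambda>t. t *\<^sub>R w"])
        show "Ck_on k {-\<epsilon><..<\<epsilon>} (\<lambda>t. t *\<^sub>R w)"
          by (rule Ck_on_bounded_linear[OF _ bounded_linear_scaleR_left Ck_on_id]) auto
      qed (use UV(7) V in \<open>auto simp: smooth_on_def\<close>)
    qed
    show "c ` {-\<epsilon><..<\<epsilon>} \<subseteq> fibre E \<Phi> (\<Phi> x)"
    proof
      fix y assume "y \<in> c ` {-\<epsilon><..<\<epsilon>}"
      then obtain t where t: "t \<in> {-\<epsilon><..<\<epsilon>}" "y = c t" by auto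
      have "y \<in> U" "F y = t *\<^sub>R w" using GU[OF V[OF t(1)]] t(2) by (auto simp: c_def)
      moreover have "?D (t *\<^sub>R w) = 0"
        using w by (simp add: linear_cmul[OF lin] vertical_space_def)
      ultimately show "y \<in> fibre E \<Phi> (\<Phi> x)"
        using DF[of y] UV(3) by (auto simp: fibre_def)
    qed
    show "c 0 = x" by (simp add: c_def G0)
    show "(c has_vector_derivative w) (at 0)"
      unfolding has_vector_derivative_def c_def
      by (rule has_derivative_compose[where f = "\<lambda>t. t *\<^sub>R w" and g = G and g' = "\<lambda>v. v"])
        (use derG in \<open>auto intro!: derivative_eq_intros\<close>)
  qed
qed

lemma open_image_submersion:
  fixes \<Phi> :: "'a::euclidean_space \<Rightarrow> 'b::euclidean_space"
  assumes "open E" "submersion_on E \<Phi>"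
  shows "open (\<Phi> ` E)"
proof -
  have \<Phi>: "smooth_on E \<Phi>" using assms(2) by (simp add: submersion_on_def)
  have "\<Phi> x \<in> interior (\<Phi> ` E)" if "x \<in> E" for x
  proof -
    note der = smooth_on_has_derivative[OF \<Phi> that]
    have "surj (frechet_derivative \<Phi> (at x))"
      using assms(2) that by (simp add: submersion_on_def)
    from linear_surjective_right_inverse[OF has_derivative_linear[OF der] this]
    obtain R where R: "linear R" "frechet_derivative \<Phi> (at x) \<circ> R = id"
      by metis
    show ?thesis
    proof (rule sussmann_open_mapping[OF assms(1) _ that der _ R(2) subset_refl])
      show "continuous_on E \<Phi>" using \<Phi> unfolding smooth_on_def by (metis Ck_on.simps(1))
    qed (use R(1) assms(1) that in \<open>simp_all add: linear_conv_bounded_linear interior_open\<close>)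
  qed
  then have "\<Phi> ` E \<subseteq> interior (\<Phi> ` E)" by blast
  then show ?thesis using interior_subset by (metis open_interior subset_antisym)
qed

lemma smooth_on_adjoint_frechet_derivative:
  fixes \<Phi> :: "'a::euclidean_space \<Rightarrow> 'b::euclidean_space"
  assumes "open E" "smooth_on E \<Phi>"
  shows "smooth_on E (\<lambda>x. adjoint (frechet_derivative \<Phi> (at x)) c)"
  unfolding smooth_on_def
proof
  fix k
  have eq: "(\<Sum>b\<in>Basis. (frechet_derivative \<Phi> (at x) b \<bullet> c) *\<^sub>R b)
      = adjoint (frechet_derivative \<Phi> (at x)) c" if "x \<in> E" for x
    using adjoint_works[OF has_derivative_linear[OF smooth_on_has_derivative[OF assms(2) that]]]
      euclidean_representation[of "adjoint (frechet_derivative \<Phi> (at x)) c"]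
    by (simp add: inner_commute)
  show "Ck_on k E (\<lambda>x. adjoint (frechet_derivative \<Phi> (at x)) c)"
  proof (rule Ck_on_cong[OF assms(1) eq])
    have "Ck_on k E (\<lambda>x. frechet_derivative \<Phi> (at x) b)" for b
      using smooth_on_frechet_derivative[OF assms(2)] by (simp add: smooth_on_def)
    then show "Ck_on k E (\<lambda>x. \<Sum>b\<in>Basis. (frechet_derivative \<Phi> (at x) b \<bullet> c) *\<^sub>R b)"
      by (intro Ck_on_sum Ck_on_scaleR Ck_on_const
          Ck_on_bounded_linear[OF _ bounded_linear_inner_left] assms(1)) auto
  qed
qed

lemma inj_adjoint_if_surj:
  fixes L :: "'a::euclidean_space \<Rightarrow> 'b::euclidean_space"
  assumes "linear L" "surj L"
  shows "inj (adjoint L)"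
proof (rule injI)
  fix c d assume eq: "adjoint L c = adjoint L d"
  obtain v where v: "c - d = L v" using assms(2) by (metis surjD)
  have "(c - d) \<bullet> (c - d) = v \<bullet> adjoint L c - v \<bullet> adjoint L d"
    by (simp add: adjoint_works[OF assms(1)] v[symmetric] inner_diff_right)
  then show "c = d" using eq by simp
qed

text \<open>
  The range of the adjoint of the differential, spanned by the gradients of the coordinates, is the
  orthogonal complement of the vertical space. The gradients of the coordinates form a global smooth
  frame, which is independent because the adjoint of a surjective map is injective.
\<close>
lemma connection_range_adjoint:
  fixes \<Phi> :: "'a::euclidean_space \<Rightarrow> 'b::euclidean_space"
  assumes "open E" "submersion_on E \<Phi>"
  shows "connection E \<Phi> (\<lambda>x. range (adjoint (frechet_derivative \<Phi> (at x))))"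
proof -
  let ?D = "\<lambda>x. frechet_derivative \<Phi> (at x)"
  have \<Phi>: "smooth_on E \<Phi>" and surj: "\<And>x. x \<in> E \<Longrightarrow> surj (?D x)"
    using assms(2) by (auto simp: submersion_on_def)
  have lin: "linear (?D x)" if "x \<in> E" for x
    using smooth_on_has_derivative[OF \<Phi> that] by (rule has_derivative_linear)
  have adj: "linear (adjoint (?D x))" "inj (adjoint (?D x))" if "x \<in> E" for x
    using lin[OF that] surj[OF that] by (auto intro: adjoint_linear inj_adjoint_if_surj)
  obtain e :: "nat \<Rightarrow> 'b" where e: "bij_betw e {..<DIM('b)} Basis"
    using ex_bij_betw_nat_finite[of "Basis :: 'b set"] by (auto simp: atLeast0LessThan)
  have img: "(\<lambda>i. adjoint (?D y) (e i)) ` {..<DIM('b)} = adjoint (?D y) ` Basis" for y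
    using e by (auto simp: bij_betw_def image_image[symmetric])
  have "smooth_subbundle E (\<lambda>x. range (adjoint (?D x)))"
    unfolding smooth_subbundle_def
  proof (intro exI[of _ "DIM('b)"] ballI exI[of _ E] exI[of _ "\<lambda>i y. adjoint (?D y) (e i)"]
      conjI allI impI)
    fix y assume y: "y \<in> E"
    show "inj_on (\<lambda>i. adjoint (?D y) (e i)) {..<DIM('b)}"
      using e adj(2)[OF y] by (auto simp: bij_betw_def inj_on_def)
    show "independent ((\<lambda>i. adjoint (?D y) (e i)) ` {..<DIM('b)})"
      unfolding img using adj[OF y] independent_Basis
      by (intro linear_independent_injective_image) auto
    show "range (adjoint (?D y)) = span ((\<lambda>i. adjoint (?D y) (e i)) ` {..<DIM('b)})"
      unfolding img using linear_span_image[OF adj(1)[OF y]] by (simp add: span_Basis)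
  qed (use assms(1) smooth_on_adjoint_frechet_derivative[OF assms(1) \<Phi>] in auto)
  moreover have "range (adjoint (?D x)) \<inter> vertical_space \<Phi> x = {0}" if "x \<in> E" for x
  proof -
    have "w = 0" if "w = adjoint (?D x) c" "?D x w = 0" for w c
      using adjoint_works[OF lin[OF \<open>x \<in> E\<close>], of w c] that by simp
    moreover have "0 \<in> range (adjoint (?D x))"
      using linear_0[OF adj(1)[OF that]] by (metis rangeI)
    ultimately show ?thesis
      using linear_0[OF lin[OF that]] by (auto simp: vertical_space_def)
  qed
  moreover have "\<exists>a\<in>range (adjoint (?D x)). \<exists>b\<in>vertical_space \<Phi> x. w = a + b"
    if "x \<in> E" for x w
  proof -
    obtain a b where ab: "a \<in> span (range (adjoint (?D x)))"
      "\<And>v. v \<in> span (range (adjoint (?D x))) \<Longrightarrow> orthogonal b v" "w = a + b"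
      using orthogonal_subspace_decomp_exists by blast
    have "?D x b \<bullet> ?D x b = 0"
      using ab(2)[OF span_base[OF rangeI]] adjoint_works[OF lin[OF that]]
      by (simp add: orthogonal_def)
    then have "b \<in> vertical_space \<Phi> x" by (simp add: vertical_space_def)
    moreover have "a \<in> range (adjoint (?D x))"
      using ab(1) span_eq_iff[THEN iffD2, OF linear_subspace_image[OF adj(1)[OF that] subspace_UNIV]]
      by metis
    ultimately show ?thesis using ab(3) by metis
  qed
  ultimately show ?thesis by (simp add: connection_def)
qed

section \<open>Horizontal lifts and zero dynamics\<close>

text \<open>
  The definite description in the horizontal lift is proper because the differential restricts to a
  bijection from the horizontal space onto the whole target: it is injective as \<open>H\<close> meets the kernel
  trivially, and surjective as \<open>H\<close> and the kernel span.
\<close>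
lemma frechet_derivative_horizontal_lift:
  assumes "connection E \<Phi> H" "submersion_on E \<Phi>" "x \<in> E"
  shows "frechet_derivative \<Phi> (at x) (horizontal_lift \<Phi> H x Y) = Y"
proof -
  let ?D = "frechet_derivative \<Phi> (at x)"
  have lin: "linear ?D"
    using smooth_on_has_derivative assms(2,3) has_derivative_linear
    unfolding submersion_on_def by blast
  have "\<exists>B. H x = span B"
    using assms(1,3) unfolding connection_def smooth_subbundle_def by meson
  then have sub: "subspace (H x)" by auto
  have vert: "w = 0" if "w \<in> H x" "?D w = 0" for w
    using assms(1,3) that unfolding connection_def vertical_space_def by blast
  obtain v where v: "?D v = Y" using assms(2,3) unfolding submersion_on_def by (metis surjD)
  obtain a b where ab: "a \<in> H x" "b \<in> vertical_space \<Phi> x" "v = a + b"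
    using assms(1,3) unfolding connection_def by blast
  have "\<exists>!w. w \<in> H x \<and> ?D w = Y"
  proof
    show "a \<in> H x \<and> ?D a = Y"
      using ab v linear_add[OF lin, of a b] by (simp add: vertical_space_def)
    then show "w = a" if "w \<in> H x \<and> ?D w = Y" for w
      using vert[of "w - a"] that subspace_diff[OF sub] by (simp add: linear_diff[OF lin])
  qed
  from theI'[OF this] show ?thesis unfolding horizontal_lift_def by blast
qed

lemma zero_dynamics_vertical:
  assumes "connection E \<Phi> H" "submersion_on E \<Phi>" "x \<in> E"
    and "frechet_derivative \<Phi> (at x) (f (x, u)) = F (\<Phi> x, \<Psi> (x, u))"
  shows "zero_dynamics f \<Phi> \<Psi> F H (x, u) \<in> vertical_space \<Phi> x"
proof -
  have "linear (frechet_derivative \<Phi> (at x))"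
    using smooth_on_has_derivative assms(2,3) has_derivative_linear
    unfolding submersion_on_def by blast
  then show ?thesis
    using frechet_derivative_horizontal_lift[OF assms(1-3)] assms(4)
    by (simp add: vertical_space_def zero_dynamics_def linear_diff)
qed

theorem mainTheorem1:
  fixes E :: "(real ^ 'n) set"
    and f0 g :: "real ^ 'n \<Rightarrow> real ^ 'n"
    and h :: "real ^ 'n \<Rightarrow> real"
    and r :: nat
    and idx :: "'r::finite \<Rightarrow> nat"
    and f :: "(real ^ 'n) \<times> real \<Rightarrow> real ^ 'n"
    and \<Phi> :: "real ^ 'n \<Rightarrow> real ^ 'r"
    and M :: "(real ^ 'r) set"
    and \<Psi> :: "(real ^ 'n) \<times> real \<Rightarrow> real"
    and ftilde :: "(real ^ 'r) \<times> real \<Rightarrow> real ^ 'r"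
  assumes "open E"
    and "smooth_on E f0" and "smooth_on E g" and "smooth_on E h"
    and "CARD('r) = r" and "1 \<le> r" and "r < CARD('n)"
    and "bij_betw idx UNIV {..<r}"
    and "\<forall>x\<in>E. relative_degree_at E f0 g h r x"
    and "f = affine_system f0 g"
    and "\<Phi> = output_map idx f0 h"
    and "M = \<Phi> ` E"
    and "static_feedback E \<Psi>"
    and "control_system_on M ftilde" and "linear_controllable_on M ftilde"
    and "\<forall>x\<in>E. \<forall>u. frechet_derivative \<Phi> (at x) (f (x, u)) = ftilde (\<Phi> x, \<Psi> (x, u))"
  shows "open M \<and> submersion_on E \<Phi> \<and>
         (\<exists>H. connection E \<Phi> H) \<and>
         (\<forall>H. connection E \<Phi> H \<longrightarrow>
           (\<forall>x\<in>E. \<forall>u.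
              zero_dynamics f \<Phi> \<Psi> ftilde H (x, u) \<in> vertical_space \<Phi> x \<and>
              tangent_to (fibre E \<Phi> (\<Phi> x)) x (zero_dynamics f \<Phi> \<Psi> ftilde H (x, u))))"
proof -
  have "smooth_on E \<Phi>" using assms(1,2,4,11) by (simp add: smooth_on_output_map)
  moreover have "surj (frechet_derivative \<Phi> (at x))" if "x \<in> E" for x
    using surj_frechet_derivative_output_map[OF assms(1-4,8) _ that] assms(9,11) by blast
  ultimately have sub: "submersion_on E \<Phi>" by (simp add: submersion_on_def)
  have vert: "zero_dynamics f \<Phi> \<Psi> ftilde H (x, u) \<in> vertical_space \<Phi> x"
    if "connection E \<Phi> H" "x \<in> E" for H x u
    using zero_dynamics_vertical[OF that(1) sub that(2)] assms(16) that(2) by blast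
  show ?thesis
  proof (intro conjI allI impI ballI)
    show "open M" using open_image_submersion[OF assms(1) sub] assms(12) by simp
    show "submersion_on E \<Phi>" by (fact sub)
    show "\<exists>H. connection E \<Phi> H" using connection_range_adjoint[OF assms(1) sub] by blast
    fix H x u assume H: "connection E \<Phi> H" "x \<in> E"
    show "zero_dynamics f \<Phi> \<Psi> ftilde H (x, u) \<in> vertical_space \<Phi> x" using vert[OF H] .
    show "tangent_to (fibre E \<Phi> (\<Phi> x)) x (zero_dynamics f \<Phi> \<Psi> ftilde H (x, u))"
      by (rule vertical_imp_tangent_to_fibre[OF assms(1) sub H(2) vert[OF H]])
  qed
qed

end
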